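(* Let $G=(\mathcal V,\mathcal E)$ be a connected graph with countable vertex set and maximal degree $\Delta<\infty$. Then for all $p,r\in[0,1]$, \[ \nu^{\mathcal V}_{r(1-p)^{\Delta}}\;\le_{\mathrm{st}}\;\mu^G_{p,r}\;\le_{\mathrm{st}}\;\nu^{\mathcal V}_{1-(1-r)(1-p)^{\Delta}}. \]
   Context: Graphs may have multiple edges (no self-loops); the degree of a vertex counts incident edges with multiplicity. For $a\in[0,1]$ and a set $S$, $\nu^S_a$ is the product Bernoulli measure on $\{0,1\}^S$ giving each coordinate value $1$ with probability $a$. The divide and color (DaC) model on $G$ with parameters $p,r$: each edge is independently open with probability $p$; the connected components of $(\mathcal V,\{\text{open edges}\})$ are bond clusters; each bond cluster is independently colored black ($1$) with probability $r$ and white ($0$) otherwise, all its vertices receiving that color; $\mu^G_{p,r}$ is the law of the resulting coloring in $\{0,1\}^{\mathcal V}$. For probability measures $\mu,\mu'$ on $\{0,1\}^{\mathcal V}$ (with the coordinatewise partial order), $\mu\le_{\mathrm{st}}\mu'$ means $\int f\,d\mu\le\int f\,d\mu'$ for every bounded increasing measurable $f$. *)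

theory Defs
  imports "HOL-Probability.Probability"
begin

text \<open>A multigraph without self-loops is given by a vertex set V, an edge set E
  and an endpoint map ends :: 'e \<Rightarrow> 'v \<times> 'v (distinct edges may share endpoints).\<close>

definition graph :: "'v set \<Rightarrow> 'e set \<Rightarrow> ('e \<Rightarrow> 'v \<times> 'v) \<Rightarrow> bool" where
  "graph V E ends \<longleftrightarrow> (\<forall>e\<in>E. fst (ends e) \<in> V \<and> snd (ends e) \<in> V \<and> fst (ends e) \<noteq> snd (ends e))"

text \<open>Adjacency relation through the edges of a subset F of edges.\<close>
definition adj :: "'e set \<Rightarrow> ('e \<Rightarrow> 'v \<times> 'v) \<Rightarrow> ('v \<times> 'v) set" where
  "adj F ends = {(x, y). \<exists>e\<in>F. ends e = (x, y) \<or> ends e = (y, x)}"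

definition connected_graph :: "'v set \<Rightarrow> 'e set \<Rightarrow> ('e \<Rightarrow> 'v \<times> 'v) \<Rightarrow> bool" where
  "connected_graph V E ends \<longleftrightarrow> (\<forall>v\<in>V. \<forall>w\<in>V. (v, w) \<in> (adj E ends)\<^sup>*)"

text \<open>Incident edges and degree (counting edges with multiplicity).\<close>
definition incident :: "'e set \<Rightarrow> ('e \<Rightarrow> 'v \<times> 'v) \<Rightarrow> 'v \<Rightarrow> 'e set" where
  "incident E ends v = {e\<in>E. fst (ends e) = v \<or> snd (ends e) = v}"

definition degree :: "'e set \<Rightarrow> ('e \<Rightarrow> 'v \<times> 'v) \<Rightarrow> 'v \<Rightarrow> nat" where
  "degree E ends v = card (incident E ends v)"

definition max_degree :: "'v set \<Rightarrow> 'e set \<Rightarrow> ('e \<Rightarrow> 'v \<times> 'v) \<Rightarrow> nat" where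
  "max_degree V E ends = (SUP v\<in>V. degree E ends v)"

text \<open>Product Bernoulli measure nu^S_a on {0,1}^S (1 = True).\<close>
definition nu :: "'a set \<Rightarrow> real \<Rightarrow> ('a \<Rightarrow> bool) measure" where
  "nu S a = PiM S (\<lambda>_. measure_pmf (bernoulli_pmf a))"

text \<open>Bond cluster representative: the vertex of the open cluster of v with least
  index in a fixed enumeration of the countable vertex set.\<close>
definition cluster_rep :: "'v set \<Rightarrow> 'e set \<Rightarrow> ('e \<Rightarrow> 'v \<times> 'v) \<Rightarrow> ('e \<Rightarrow> bool) \<Rightarrow> 'v \<Rightarrow> 'v" where
  "cluster_rep V E ends \<omega> v =
     (ARG_MIN (to_nat_on V) w. w \<in> V \<and> (v, w) \<in> (adj {e\<in>E. \<omega> e} ends)\<^sup>*)"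

text \<open>Coloring from an edge configuration and independent cluster colors: each
  cluster receives the color variable of its representative.\<close>
definition dac_coloring :: "'v set \<Rightarrow> 'e set \<Rightarrow> ('e \<Rightarrow> 'v \<times> 'v) \<Rightarrow> ('e \<Rightarrow> bool) \<times> ('v \<Rightarrow> bool) \<Rightarrow> 'v \<Rightarrow> bool" where
  "dac_coloring V E ends oc = (\<lambda>v\<in>V. snd oc (cluster_rep V E ends (fst oc) v))"

text \<open>The divide and color measure mu^G_{p,r}.\<close>
definition DaC :: "'v set \<Rightarrow> 'e set \<Rightarrow> ('e \<Rightarrow> 'v \<times> 'v) \<Rightarrow> real \<Rightarrow> real \<Rightarrow> ('v \<Rightarrow> bool) measure" where
  "DaC V E ends p r =
     distr (nu E p \<Otimes>\<^sub>M nu V r) (PiM V (\<lambda>_. count_space UNIV)) (dac_coloring V E ends)"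

text \<open>Stochastic domination w.r.t. the coordinatewise order (False < True).\<close>
definition st_le :: "'a measure \<Rightarrow> 'a measure \<Rightarrow> ('a::order) measure \<Rightarrow> bool" where
  "st_le M N S \<longleftrightarrow> (\<forall>f :: 'a \<Rightarrow> real. f \<in> borel_measurable S \<longrightarrow>
      (\<exists>B. \<forall>x\<in>space S. \<bar>f x\<bar> \<le> B) \<longrightarrow>
      (\<forall>x\<in>space S. \<forall>y\<in>space S. x \<le> y \<longrightarrow> f x \<le> f y) \<longrightarrow>
      integral\<^sup>L M f \<le> integral\<^sup>L N f)"

end

theory Submission
  imports Defs
begin

text \<open>On a finite graph, reveal the edges one at a time: an edge between the cluster explored so
  far and an unexplored vertex w passes the colour of the cluster on to w if it is open, and when
  no such edge is left a new cluster is started with a fresh colour. A vertex fails to be black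
  only if one of the edges examined towards it is open or its fresh colour is white. Every edge is
  examined towards only one of its endpoints, so induction along the exploration gives domination
  of the product measure with density \<open>r (1 - p)^\<Delta>\<close>. (Conditioning on the colours of vertices in a
  fixed order would not do: these conditional probabilities have no uniform lower bound.)

  The colour of a vertex in an infinite graph is the eventual value of its colours in
  finite induced subgraphs, which settles increasing events depending on finitely many vertices.
  By inner regularity an increasing event contains, up to small measure, the upward closure
  of a compact set, and this closure is a decreasing limit of such finitary events.
  The upper bound follows by exchanging the colours.\<close>

section \<open>Expectation over a random subset\<close>

text \<open>A finite product Bernoulli law on subsets, written as a plain sum so that conditioning
  on one element is an algebraic identity.\<close>

definition bexp :: "('a \<Rightarrow> real) \<Rightarrow> 'a set \<Rightarrow> ('a set \<Rightarrow> real) \<Rightarrow> real" where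
  "bexp a S g = (\<Sum>T\<in>Pow S. (\<Prod>x\<in>T. a x) * (\<Prod>x\<in>S - T. 1 - a x) * g T)"

lemma bexp_empty [simp]: "bexp a {} g = g {}"
  by (simp add: bexp_def)

lemma bexp_insert:
  assumes "finite S" "x \<notin> S"
  shows "bexp a (insert x S) g = a x * bexp a S (\<lambda>T. g (insert x T)) + (1 - a x) * bexp a S g"
proof -
  let ?w = "\<lambda>T. (\<Prod>y\<in>T. a y) * (\<Prod>y\<in>insert x S - T. 1 - a y) * g T"
  have inj: "inj_on (insert x) (Pow S)"
    using assms(2) by (auto simp: inj_on_def)
  have "bexp a (insert x S) g = sum ?w (Pow S) + sum ?w (insert x ` Pow S)"
    unfolding bexp_def Pow_insert using assms by (intro sum.union_disjoint) auto
  also have "sum ?w (Pow S) = (1 - a x) * bexp a S g"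
    unfolding bexp_def sum_distrib_left
  proof (rule sum.cong)
    fix T assume "T \<in> Pow S"
    hence "insert x S - T = insert x (S - T)" "x \<notin> S - T" using assms by auto
    thus "?w T = (1 - a x) * ((\<Prod>y\<in>T. a y) * (\<Prod>y\<in>S - T. 1 - a y) * g T)"
      using assms by simp
  qed simp
  also have "sum ?w (insert x ` Pow S) = a x * bexp a S (\<lambda>T. g (insert x T))"
    unfolding bexp_def sum_distrib_left sum.reindex[OF inj] o_def
  proof (rule sum.cong)
    fix T assume T: "T \<in> Pow S"
    hence "insert x S - insert x T = S - T" "x \<notin> T" "finite T" using assms finite_subset by auto
    thus "?w (insert x T) = a x * ((\<Prod>y\<in>T. a y) * (\<Prod>y\<in>S - T. 1 - a y) * g (insert x T))"
      by simp
  qed simp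
  finally show ?thesis by simp
qed

lemma bexp_remove:
  assumes "finite S" "x \<in> S"
  shows "bexp a S g = a x * bexp a (S - {x}) (\<lambda>T. g (insert x T)) + (1 - a x) * bexp a (S - {x}) g"
  using bexp_insert[of "S - {x}" x a g] assms by (simp add: insert_absorb)

lemma bexp_cong:
  assumes "\<And>x. x \<in> S \<Longrightarrow> a x = b x" "\<And>T. T \<subseteq> S \<Longrightarrow> g T = h T"
  shows "bexp a S g = bexp b S h"
  unfolding bexp_def using assms
  by (intro sum.cong arg_cong2[where f = "(*)"] prod.cong) auto

lemma bexp_mono:
  assumes "\<And>x. x \<in> S \<Longrightarrow> 0 \<le> a x \<and> a x \<le> 1" "\<And>T. T \<subseteq> S \<Longrightarrow> g T \<le> h T"
  shows "bexp a S g \<le> bexp a S h"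
  unfolding bexp_def using assms
  by (intro sum_mono mult_left_mono mult_nonneg_nonneg prod_nonneg) (auto simp: subset_iff)

lemma bexp_linear: "bexp a S (\<lambda>T. c * g T + d * h T) = c * bexp a S g + d * bexp a S h"
  unfolding bexp_def sum_distrib_left sum.distrib[symmetric]
  by (intro sum.cong) (auto simp: algebra_simps)

lemma bexp_const:
  assumes "finite S" shows "bexp a S (\<lambda>_. c) = c"
  using assms by (induction S) (simp_all add: bexp_insert algebra_simps)

lemma bexp_le_insert:
  assumes "\<And>x. x \<in> S \<Longrightarrow> 0 \<le> a x \<and> a x \<le> 1" "mono_on (Pow S) g" "x \<in> S"
  shows "bexp a (S - {x}) g \<le> bexp a (S - {x}) (\<lambda>T. g (insert x T))"
proof (rule bexp_mono)
  show "g T \<le> g (insert x T)" if "T \<subseteq> S - {x}" for T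
    using that assms(3) by (intro monotone_onD[OF assms(2)]) auto
qed (use assms in auto)

text \<open>Conditioning on one element \<open>x\<close> gives \<open>B + a x * (A - B)\<close>,
  where \<open>A\<close> and \<open>B\<close> are the values with and without \<open>x\<close>.
  Monotonicity of \<open>g\<close> makes \<open>A - B\<close> nonnegative, so this grows with
  \<open>a x\<close>.\<close>

lemma bexp_mono_param:
  assumes "finite S" "\<And>x. x \<in> S \<Longrightarrow> 0 \<le> a x \<and> a x \<le> b x \<and> b x \<le> 1" "mono_on (Pow S) g"
  shows "bexp a S g \<le> bexp b S g"
  using assms
proof (induction S arbitrary: g rule: finite_induct)
  case (insert x S)
  have um: "mono_on (Pow S) g" "mono_on (Pow S) (\<lambda>T. g (insert x T))"
    by (intro monotone_onI monotone_onD[OF insert.prems(2)]; auto)+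
  have ab: "0 \<le> a x" "a x \<le> b x" "b x \<le> 1" "a x \<le> 1"
    using insert.prems(1)[of x] by auto
  define A B where "A = bexp b S (\<lambda>T. g (insert x T))" and "B = bexp b S g"
  have b01: "0 \<le> b y \<and> b y \<le> 1" if "y \<in> insert x S" for y
    using insert.prems(1)[OF that] by linarith
  hence "B \<le> A"
    using bexp_le_insert[of "insert x S" b g x, OF b01 insert.prems(2)] insert.hyps
    unfolding A_def B_def by simp
  have "a x * bexp a S (\<lambda>T. g (insert x T)) + (1 - a x) * bexp a S g \<le> a x * A + (1 - a x) * B"
    using insert.IH[OF _ um(1)] insert.IH[OF _ um(2)] insert.prems(1) ab
    unfolding A_def B_def by (intro add_mono mult_left_mono) simp_all
  also have "\<dots> = B + a x * (A - B)" by (simp add: algebra_simps)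
  also have "\<dots> \<le> B + b x * (A - B)" using ab \<open>B \<le> A\<close> by (intro add_left_mono mult_right_mono) auto
  also have "\<dots> = b x * A + (1 - b x) * B" by (simp add: algebra_simps)
  finally show ?case using insert.hyps by (simp add: bexp_insert A_def B_def)
qed simp

section \<open>Exploration of a finite graph\<close>

definition cluster :: "'e set \<Rightarrow> ('e \<Rightarrow> 'v \<times> 'v) \<Rightarrow> 'v \<Rightarrow> 'v set" where
  "cluster F ends v = {w. (v, w) \<in> (adj F ends)\<^sup>*}"

text \<open>Here A is the explored part, whose colour s is already known, and U the unexplored part;
  D holds the vertices of U whose own colour variable is True.\<close>
definition coloured ::
  "('v \<Rightarrow> nat) \<Rightarrow> ('e \<Rightarrow> 'v \<times> 'v) \<Rightarrow> 'v set \<Rightarrow> bool \<Rightarrow> 'v set \<Rightarrow> 'e set \<Rightarrow> 'v set \<Rightarrow> 'v set" where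
  "coloured idx ends A s U F D =
     {v\<in>U. if cluster F ends v \<inter> A \<noteq> {} then s
           else (ARG_MIN idx w. w \<in> U \<and> w \<in> cluster F ends v) \<in> D}"

section \<open>Clusters when one edge is added\<close>

lemma adj_mono: "F \<subseteq> F' \<Longrightarrow> adj F ends \<subseteq> adj F' ends"
  by (auto simp: adj_def)

lemma cluster_mono: "F \<subseteq> F' \<Longrightarrow> cluster F ends v \<subseteq> cluster F' ends v"
  using rtrancl_mono[OF adj_mono[of F F' ends]] by (auto simp: cluster_def)

lemma cluster_refl [simp]: "v \<in> cluster F ends v"
  by (simp add: cluster_def)

text \<open>A path from \<open>v\<close> that uses \<open>e\<close> would first have to reach an
  endpoint of \<open>e\<close> without it. The first assumption lets \<open>e\<close> join
  \<open>x\<close> and \<open>y\<close> in either orientation.\<close>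

lemma cluster_insert_avoid:
  assumes "(x, y) \<in> adj {e} ends" "x \<notin> cluster F ends v" "y \<notin> cluster F ends v"
  shows "cluster (insert e F) ends v = cluster F ends v"
proof
  show "cluster (insert e F) ends v \<subseteq> cluster F ends v"
  proof
    fix w assume "w \<in> cluster (insert e F) ends v"
    hence "(v, w) \<in> (adj (insert e F) ends)\<^sup>*" by (simp add: cluster_def)
    thus "w \<in> cluster F ends v"
    proof (induction rule: rtrancl_induct)
      case (step w z)
      hence "(w, z) \<in> adj F ends"
        using assms by (auto simp: adj_def)
      thus ?case using step.IH by (auto simp: cluster_def)
    qed simp
  qed
qed (auto intro!: cluster_mono)

text \<open>Since \<open>x\<close> already lies in \<open>A\<close>, reaching \<open>A\<close> with
  the help of \<open>e\<close> amounts to reaching \<open>A\<close> or \<open>y\<close> without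
  it.\<close>

lemma cluster_insert_meets:
  assumes e: "(x, y) \<in> adj {e} ends" and x: "x \<in> A"
  shows "cluster (insert e F) ends v \<inter> A \<noteq> {} \<longleftrightarrow> cluster F ends v \<inter> insert y A \<noteq> {}"
proof
  assume L: "cluster (insert e F) ends v \<inter> A \<noteq> {}"
  show "cluster F ends v \<inter> insert y A \<noteq> {}"
  proof
    assume *: "cluster F ends v \<inter> insert y A = {}"
    hence "cluster (insert e F) ends v = cluster F ends v"
      using x by (intro cluster_insert_avoid[OF e]) auto
    thus False using L * by auto
  qed
next
  assume R: "cluster F ends v \<inter> insert y A \<noteq> {}"
  have sub: "cluster F ends v \<subseteq> cluster (insert e F) ends v" by (auto intro!: cluster_mono)
  have "(y, x) \<in> adj (insert e F) ends" using e by (auto simp: adj_def)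
  hence "y \<in> cluster F ends v \<Longrightarrow> x \<in> cluster (insert e F) ends v"
    using sub by (auto simp: cluster_def)
  thus "cluster (insert e F) ends v \<inter> A \<noteq> {}" using R sub x by auto
qed

section \<open>One exploration step for a fixed configuration\<close>

lemma eq_insert_ifI:
  assumes "\<And>v. v \<noteq> y \<Longrightarrow> v \<in> X \<longleftrightarrow> v \<in> Y" "y \<in> X \<longleftrightarrow> b" "y \<notin> Y"
  shows "X = (if b then insert y else id) Y"
proof (rule set_eqI)
  show "v \<in> X \<longleftrightarrow> v \<in> (if b then insert y else id) Y" for v
    using assms by (cases "v = y") auto
qed

text \<open>The open edge puts \<open>y\<close> into a cluster of colour \<open>s\<close>, so
  \<open>y\<close> moves to the explored part. A cluster avoiding \<open>insert y A\<close> does not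
  contain \<open>y\<close>, hence keeps its representative when \<open>y\<close> leaves
  \<open>U\<close>.\<close>

lemma coloured_open:
  assumes e: "(x, y) \<in> adj {e} ends" and x: "x \<in> A" and y: "y \<in> U"
  shows "coloured idx ends A s U (insert e F) D =
    (if s then insert y else id) (coloured idx ends (insert y A) s (U - {y}) F D)"
proof -
  have "v \<in> coloured idx ends A s U (insert e F) D \<longleftrightarrow>
      v \<in> coloured idx ends (insert y A) s (U - {y}) F D" if "v \<noteq> y" for v
  proof (cases "cluster F ends v \<inter> insert y A \<noteq> {}")
    case True
    thus ?thesis using that cluster_insert_meets[where v=v, OF e x] by (simp add: coloured_def)
  next
    case False
    have "cluster (insert e F) ends v = cluster F ends v"
      using x False by (intro cluster_insert_avoid[OF e]) auto
    moreover have "(\<lambda>w. w \<in> U \<and> w \<in> cluster F ends v) = (\<lambda>w. w \<in> U - {y} \<and> w \<in> cluster F ends v)"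
      using False by auto
    ultimately show ?thesis using that False by (simp add: coloured_def)
  qed
  moreover have "y \<in> coloured idx ends A s U (insert e F) D \<longleftrightarrow> s"
  proof -
    have "cluster F ends y \<inter> insert y A \<noteq> {}" using cluster_refl by fastforce
    thus ?thesis using y cluster_insert_meets[where v=y, OF e x] by (simp add: coloured_def)
  qed
  moreover have "y \<notin> coloured idx ends (insert y A) s (U - {y}) F D" by (simp add: coloured_def)
  ultimately show ?thesis by (rule eq_insert_ifI)
qed

text \<open>No edge leaves \<open>U\<close>, so the clusters of its vertices stay inside
  \<open>U\<close> and the old \<open>A\<close> can be forgotten. As the vertex of least index,
  \<open>y\<close> represents every cluster containing it, and its own variable becomes the colour
  passed on.\<close>

lemma coloured_seed:
  assumes closed: "\<And>u w. (u, w) \<in> adj F ends \<Longrightarrow> u \<in> U \<Longrightarrow> w \<in> U" and "A \<inter> U = {}"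
    and y: "y \<in> U" "\<And>u. u \<in> U \<Longrightarrow> u \<noteq> y \<Longrightarrow> idx y < idx u"
  shows "coloured idx ends A s U F D =
    (if y \<in> D then insert y else id) (coloured idx ends {y} (y \<in> D) (U - {y}) F D)"
proof -
  have sub: "cluster F ends v \<subseteq> U" if "v \<in> U" for v
  proof
    fix w assume "w \<in> cluster F ends v"
    hence "(v, w) \<in> (adj F ends)\<^sup>*" by (simp add: cluster_def)
    thus "w \<in> U" by (induction) (use that closed in auto)
  qed
  have rep: "(ARG_MIN idx w. w \<in> U \<and> w \<in> cluster F ends v) = y" if "y \<in> cluster F ends v" for v
  proof -
    let ?P = "\<lambda>w. w \<in> U \<and> w \<in> cluster F ends v"
    have "?P (arg_min idx ?P)" "idx (arg_min idx ?P) \<le> idx y"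
      using y(1) that arg_min_natI[of ?P y] arg_min_nat_le[of ?P y] by auto
    thus ?thesis using y(2) by force
  qed
  have "v \<in> coloured idx ends A s U F D \<longleftrightarrow>
      v \<in> coloured idx ends {y} (y \<in> D) (U - {y}) F D" if "v \<noteq> y" for v
  proof (cases "v \<in> U")
    case True
    hence nA: "cluster F ends v \<inter> A = {}" using sub assms(2) by blast
    show ?thesis
    proof (cases "y \<in> cluster F ends v")
      case True
      thus ?thesis using nA rep[of v] that by (simp add: coloured_def)
    next
      case False
      hence "(\<lambda>w. w \<in> U \<and> w \<in> cluster F ends v) = (\<lambda>w. w \<in> U - {y} \<and> w \<in> cluster F ends v)"
        by auto
      thus ?thesis using nA that False by (simp add: coloured_def)
    qed
  qed (simp add: coloured_def)
  moreover have "y \<in> coloured idx ends A s U F D \<longleftrightarrow> y \<in> D"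
    using y(1) sub[of y] assms(2) rep[of y] by (auto simp: coloured_def)
  moreover have "y \<notin> coloured idx ends {y} (y \<in> D) (U - {y}) F D" by (simp add: coloured_def)
  ultimately show ?thesis by (rule eq_insert_ifI)
qed

text \<open>Representatives always lie in \<open>U\<close>.\<close>

lemma coloured_cong:
  assumes "\<And>v. v \<in> U \<Longrightarrow> v \<in> D \<longleftrightarrow> v \<in> D'"
  shows "coloured idx ends A s U F D = coloured idx ends A s U F D'"
proof -
  have "(ARG_MIN idx w. w \<in> U \<and> w \<in> cluster F ends v) \<in> U" if "v \<in> U" for v
    using arg_min_natI[of "\<lambda>w. w \<in> U \<and> w \<in> cluster F ends v" v] that by simp
  thus ?thesis unfolding coloured_def using assms by (intro Collect_cong conj_cong refl if_cong) blast+
qed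

section \<open>One exploration step in expectation\<close>

definition dac_exp ::
  "real \<Rightarrow> real \<Rightarrow> ('v \<Rightarrow> nat) \<Rightarrow> ('e \<Rightarrow> 'v \<times> 'v) \<Rightarrow> 'v set \<Rightarrow> bool \<Rightarrow> 'v set \<Rightarrow> 'e set \<Rightarrow> ('v set \<Rightarrow> real) \<Rightarrow> real" where
  "dac_exp p q idx ends A s U F g =
     bexp (\<lambda>_. p) F (\<lambda>H. bexp (\<lambda>_. q) U (\<lambda>D. g (coloured idx ends A s U H D)))"

text \<open>The degree counts only the edges of \<open>F\<close>, those still to be examined: each
  examined edge takes one factor \<open>1 - p\<close> off the weight of its unexplored
  endpoint.\<close>

definition weight :: "real \<Rightarrow> real \<Rightarrow> 'e set \<Rightarrow> ('e \<Rightarrow> 'v \<times> 'v) \<Rightarrow> 'v \<Rightarrow> real" where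
  "weight p q F ends v = q * (1 - p) ^ degree F ends v"

text \<open>Conditioning on the state of \<open>e\<close>: if it is open,
  \<open>coloured_open\<close> applies and the own variable of \<open>y\<close> integrates out; if
  it is closed, \<open>e\<close> is dropped.\<close>

lemma dac_exp_edge:
  assumes "finite F" "finite U" "e \<in> F" 
    and e: "(x, y) \<in> adj {e} ends" "x \<in> A" "y \<in> U"
  shows "dac_exp p q idx ends A s U F g =
    p * dac_exp p q idx ends (insert y A) s (U - {y}) (F - {e}) (\<lambda>T. g ((if s then insert y else id) T))
    + (1 - p) * dac_exp p q idx ends A s U (F - {e}) g"
proof -
  have "bexp (\<lambda>_. q) U (\<lambda>D. g (coloured idx ends A s U (insert e H) D)) =
     bexp (\<lambda>_. q) (U - {y}) (\<lambda>D. g ((if s then insert y else id) (coloured idx ends (insert y A) s (U - {y}) H D)))"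
    (is "_ = bexp _ _ ?h") for H
  proof -
    have "bexp (\<lambda>_. q) U (\<lambda>D. g (coloured idx ends A s U (insert e H) D)) = bexp (\<lambda>_. q) U ?h"
      by (subst coloured_open[OF e]) simp
    also have "\<dots> = q * bexp (\<lambda>_. q) (U - {y}) (\<lambda>D. ?h (insert y D)) + (1 - q) * bexp (\<lambda>_. q) (U - {y}) ?h"
      using assms by (intro bexp_remove) auto
    \<comment> \<open>The colouring of \<open>U - {y}\<close> does not see whether \<open>y\<close>
      lies in \<open>D\<close>, so both branches of conditioning on \<open>y\<close> agree and their
      weights add up to 1.\<close>
    also have "(\<lambda>D. ?h (insert y D)) = ?h"
    proof
      fix D show "?h (insert y D) = ?h D"
        using coloured_cong[of "U - {y}" "insert y D" D idx ends "insert y A" s H] by simp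
    qed
    finally show ?thesis by (simp add: algebra_simps)
  qed
  thus ?thesis unfolding dac_exp_def using assms by (subst bexp_remove[of F e]) auto
qed

text \<open>Conditioning on \<open>y \<in> D\<close>, which by \<open>coloured_seed\<close> decides
  the colour of the new cluster started at \<open>y\<close>.\<close>

lemma dac_exp_seed:
  assumes "finite F" "finite U"
    and "\<And>u w. (u, w) \<in> adj F ends \<Longrightarrow> u \<in> U \<Longrightarrow> w \<in> U" "A \<inter> U = {}"
    and y: "y \<in> U" "\<And>u. u \<in> U \<Longrightarrow> u \<noteq> y \<Longrightarrow> idx y < idx u"
  shows "dac_exp p q idx ends A s U F g =
    q * dac_exp p q idx ends {y} True (U - {y}) F (\<lambda>T. g (insert y T))
    + (1 - q) * dac_exp p q idx ends {y} False (U - {y}) F g"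
proof -
  have "bexp (\<lambda>_. q) U (\<lambda>D. g (coloured idx ends A s U H D)) =
     q * bexp (\<lambda>_. q) (U - {y}) (\<lambda>D. g (insert y (coloured idx ends {y} True (U - {y}) H D))) +
     (1 - q) * bexp (\<lambda>_. q) (U - {y}) (\<lambda>D. g (coloured idx ends {y} False (U - {y}) H D))"
    if H: "H \<subseteq> F" for H
  proof -
    have seed: "coloured idx ends A s U H D =
      (if y \<in> D then insert y else id) (coloured idx ends {y} (y \<in> D) (U - {y}) H D)" for D
    proof (rule coloured_seed)
      show "w \<in> U" if "(u, w) \<in> adj H ends" "u \<in> U" for u w
        using that adj_mono[OF H, of ends] by (intro assms(3)[of u w]) auto
    qed (use assms in auto)
    have 1: "coloured idx ends A s U H (insert y D) = insert y (coloured idx ends {y} True (U - {y}) H D)" for D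
    proof -
      have "coloured idx ends {y} True (U - {y}) H (insert y D) = coloured idx ends {y} True (U - {y}) H D"
        by (rule coloured_cong) auto
      thus ?thesis using seed[of "insert y D"] by simp
    qed
    have 2: "coloured idx ends A s U H D = coloured idx ends {y} False (U - {y}) H D"
      if "D \<subseteq> U - {y}" for D
    proof -
      have "y \<notin> D" using that by auto
      thus ?thesis using seed[of D] by simp
    qed
    have "bexp (\<lambda>_. q) (U - {y}) (\<lambda>D. g (coloured idx ends A s U H D)) =
        bexp (\<lambda>_. q) (U - {y}) (\<lambda>D. g (coloured idx ends {y} False (U - {y}) H D))"
      by (rule bexp_cong) (simp_all only: 2)
    thus ?thesis using bexp_remove[OF assms(2) y(1), of "\<lambda>_. q"] by (simp only: 1)
  qed
  thus ?thesis unfolding dac_exp_def bexp_linear[symmetric] by (intro bexp_cong) simp_all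
qed

section \<open>Induction along the exploration\<close>

lemma incident_remove: 
  assumes "e \<in> F" "(x, y) \<in> adj {e} ends" "v \<noteq> x" 
  shows "incident (F - {e}) ends v = (if v = y then incident F ends v - {e} else incident F ends v)"
  using assms by (auto simp: incident_def adj_def)

text \<open>Stated for every intermediate state of the exploration, so \<open>A\<close> and
  \<open>s\<close> are arbitrary and the bound has to survive \<open>s = False\<close>. Examining an
  edge shrinks \<open>F\<close>, starting a cluster shrinks \<open>U\<close>; hence the measure
  \<open>card F + card U\<close>.\<close>

lemma dac_exp_ge:
  assumes "finite F" "finite U" "A \<inter> U = {}" "inj_on idx U"
    and "\<And>u w. (u, w) \<in> adj F ends \<Longrightarrow> u \<in> U \<Longrightarrow> w \<in> A \<union> U"
    and pq: "0 \<le> p" "p \<le> 1" "0 \<le> q" "q \<le> 1"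
    and "mono_on (Pow U) g"
  shows "bexp (weight p q F ends) U g \<le> dac_exp p q idx ends A s U F g"
  using assms(1-5,10)
proof (induction "card F + card U" arbitrary: F U A s g rule: less_induct)
  case less
  note fin = less.prems(1,2) and disj = less.prems(3) and inj = less.prems(4)
    and cl = less.prems(5) and mono = less.prems(6)
  have mono': "mono_on (Pow (U - {y})) g" "mono_on (Pow (U - {y})) (\<lambda>T. g (insert y T))" if "y \<in> U" for y
    using that by (intro monotone_onI monotone_onD[OF mono]; auto)+
  have w01: "0 \<le> weight p q H ends v \<and> weight p q H ends v \<le> q" for H v
    using pq by (auto simp: weight_def mult_left_le power_le_one)
  hence w1: "0 \<le> weight p q H ends v \<and> weight p q H ends v \<le> 1" for H v
    using pq by (meson order_trans)
  consider "U = {}" | (edge) x y where "x \<in> A" "y \<in> U" "(y, x) \<in> adj F ends"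
    | (seed) "U \<noteq> {}" "\<forall>x\<in>A. \<forall>y\<in>U. (y, x) \<notin> adj F ends" by blast
  thus ?case
  proof cases
    case 1
    thus ?thesis using fin by (simp add: dac_exp_def bexp_const coloured_def)
  next
    case edge
    then obtain e where e: "e \<in> F" "(x, y) \<in> adj {e} ends" by (auto simp: adj_def)
    have xU: "x \<notin> U" using edge disj by auto
    hence "x \<noteq> y" using edge by auto
    define G0 G1 where "G0 = bexp (weight p q F ends) (U - {y}) g"
      and "G1 = bexp (weight p q F ends) (U - {y}) (\<lambda>T. g (insert y T))"
    define a where "a = weight p q (F - {e}) ends y"
    \<comment> \<open>Deleting \<open>e\<close> changes only the degrees of \<open>x\<close> and
      \<open>y\<close>, and \<open>x\<close> lies outside \<open>U\<close>.\<close>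
    have we: "weight p q (F - {e}) ends v = weight p q F ends v" if "v \<in> U - {y}" for v
    proof -
      have "v \<noteq> x" using that xU by auto
      thus ?thesis using incident_remove[OF e] that by (simp add: weight_def degree_def)
    qed
    have eq: "bexp (weight p q (F - {e}) ends) (U - {y}) h = bexp (weight p q F ends) (U - {y}) h" for h
      by (rule bexp_cong) (simp_all add: we)
    have "incident (F - {e}) ends y = incident F ends y - {e}"
      using incident_remove[OF e \<open>x \<noteq> y\<close>[symmetric]] by simp
    moreover have "e \<in> incident F ends y" using e by (auto simp: incident_def adj_def)
    moreover have "finite (incident F ends y)" using fin by (simp add: incident_def)
    ultimately have "degree F ends y = Suc (degree (F - {e}) ends y)"
      unfolding degree_def using card_Suc_Diff1[of "incident F ends y" e] by simp
    hence wy: "weight p q F ends y = (1 - p) * a" by (simp add: weight_def a_def)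
    have adjF: "adj (F - {e}) ends \<subseteq> adj F ends" by (intro adj_mono) auto
    \<comment> \<open>If \<open>e\<close> is open, the worst case is \<open>s = False\<close>, where
      \<open>y\<close> is left out. By monotonicity \<open>G0\<close> is a lower bound for either
      value of \<open>s\<close>.\<close>
    have "G0 \<le> bexp (weight p q (F - {e}) ends) (U - {y}) (\<lambda>T. g ((if s then insert y else id) T))"
    proof -
      show ?thesis using bexp_le_insert[of U "weight p q (F - {e}) ends" g y, OF w1 mono edge(2)]
        by (simp add: G0_def eq)
    qed
    also have "\<dots> \<le> dac_exp p q idx ends (insert y A) s (U - {y}) (F - {e}) (\<lambda>T. g ((if s then insert y else id) T))"
    proof (rule less.hyps)
      show "card (F - {e}) + card (U - {y}) < card F + card U"
        using fin e edge by (intro add_strict_mono card_Diff1_less) auto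
      show "mono_on (Pow (U - {y})) (\<lambda>T. g ((if s then insert y else id) T))"
        using mono'[OF edge(2)] by (cases s) simp_all
      show "w \<in> insert y A \<union> (U - {y})" if "(u, w) \<in> adj (F - {e}) ends" "u \<in> U - {y}" for u w
        using cl[of u w] that adjF by blast
      show "inj_on idx (U - {y})" using inj by (rule inj_on_subset) auto
    qed (use fin disj in auto)
    finally have 1: "G0 \<le> dac_exp p q idx ends (insert y A) s (U - {y}) (F - {e}) (\<lambda>T. g ((if s then insert y else id) T))" .
    have "a * G1 + (1 - a) * G0 = bexp (weight p q (F - {e}) ends) U g"
      using fin edge by (subst bexp_remove[of U y]) (simp_all add: G0_def G1_def a_def eq)
    also have "\<dots> \<le> dac_exp p q idx ends A s U (F - {e}) g"
    proof (rule less.hyps)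
      show "card (F - {e}) + card U < card F + card U"
        using fin e edge by (intro add_strict_right_mono card_Diff1_less) auto
      show "w \<in> A \<union> U" if "(u, w) \<in> adj (F - {e}) ends" "u \<in> U" for u w
        using cl[of u w] that adjF by blast
    qed (use fin disj inj mono in auto)
    finally have 2: "a * G1 + (1 - a) * G0 \<le> dac_exp p q idx ends A s U (F - {e}) g" .
    \<comment> \<open>By \<open>wy\<close>, selecting \<open>y\<close> splits into \<open>e\<close>
      being closed, with probability \<open>1 - p\<close>, and a selection with probability
      \<open>a\<close>. Conditioning on \<open>y\<close> thus mirrors conditioning on
      \<open>e\<close>.\<close>
    have "bexp (weight p q F ends) U g = p * G0 + (1 - p) * (a * G1 + (1 - a) * G0)"
      using fin edge by (subst bexp_remove[of U y]) (simp_all add: G0_def G1_def wy algebra_simps)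
    also have "\<dots> \<le> dac_exp p q idx ends A s U F g"
      unfolding dac_exp_edge[OF fin e edge(1,2)] using 1 2 pq by (intro add_mono mult_left_mono) auto
    finally show ?thesis .
  next
    case seed
    \<comment> \<open>The vertex of least index represents its own cluster; injectivity makes the
      minimum strict, as \<open>dac_exp_seed\<close> requires.\<close>
    obtain y where y: "y \<in> U" "\<And>u. u \<in> U \<Longrightarrow> idx y \<le> idx u"
      using seed(1) arg_min_natI[of "\<lambda>u. u \<in> U"] arg_min_nat_le[of "\<lambda>u. u \<in> U"] by blast
    hence y': "idx y < idx u" if "u \<in> U" "u \<noteq> y" for u
      using inj that by (metis inj_onD order_le_less)
    define G0 G1 where "G0 = bexp (weight p q F ends) (U - {y}) g"
      and "G1 = bexp (weight p q F ends) (U - {y}) (\<lambda>T. g (insert y T))"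
    let ?a = "weight p q F ends y"
    have cl': "w \<in> U" if "(u, w) \<in> adj F ends" "u \<in> U" for u w
      using cl seed(2) that by blast
    have less: "card F + card (U - {y}) < card F + card U"
      using fin y by (intro add_strict_left_mono card_Diff1_less) auto
    have 1: "G1 \<le> dac_exp p q idx ends {y} True (U - {y}) F (\<lambda>T. g (insert y T))"
      unfolding G1_def
    proof (rule less.hyps[OF less])
      show "mono_on (Pow (U - {y})) (\<lambda>T. g (insert y T))" using mono'(2) y(1) .
      show "w \<in> {y} \<union> (U - {y})" if "(u, w) \<in> adj F ends" "u \<in> U - {y}" for u w
        using cl'[of u w] that by blast
      show "inj_on idx (U - {y})" using inj by (rule inj_on_subset) auto
    qed (use fin in auto)
    have 2: "G0 \<le> dac_exp p q idx ends {y} False (U - {y}) F g"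
      unfolding G0_def
    proof (rule less.hyps[OF less])
      show "mono_on (Pow (U - {y})) g" using mono'(1) y(1) .
      show "w \<in> {y} \<union> (U - {y})" if "(u, w) \<in> adj F ends" "u \<in> U - {y}" for u w
        using cl'[of u w] that by blast
      show "inj_on idx (U - {y})" using inj by (rule inj_on_subset) auto
    qed (use fin in auto)
    have "G0 \<le> G1" unfolding G0_def G1_def using w1 mono y by (intro bexp_le_insert) auto
    have "bexp (weight p q F ends) U g = G0 + ?a * (G1 - G0)"
      using fin y by (subst bexp_remove[of U y]) (simp_all add: G0_def G1_def algebra_simps)
    \<comment> \<open>A fresh colour has density \<open>q\<close>, which is at least the weight of
      \<open>y\<close>; because \<open>G0 \<le> G1\<close>, a larger density gives a larger
      value.\<close>
    also have "\<dots> \<le> G0 + q * (G1 - G0)"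
      using w01 \<open>G0 \<le> G1\<close> by (intro add_left_mono mult_right_mono) auto
    also have "\<dots> = q * G1 + (1 - q) * G0" by (simp add: algebra_simps)
    also have "\<dots> \<le> q * dac_exp p q idx ends {y} True (U - {y}) F (\<lambda>T. g (insert y T))
        + (1 - q) * dac_exp p q idx ends {y} False (U - {y}) F g"
      using 1 2 pq by (intro add_mono mult_left_mono) auto
    also have "\<dots> = dac_exp p q idx ends A s U F g"
      by (rule dac_exp_seed[symmetric]) (fact fin cl' disj y(1) y')+
    finally show ?thesis .
  qed
qed

section \<open>From finitary events to all increasing events\<close>

text \<open>The parameter b lets one argument serve for increasing events (b = True) and,
  by exchanging the colours, for decreasing ones (b = False).\<close>
definition level_set :: "'a set \<Rightarrow> bool \<Rightarrow> ('a \<Rightarrow> bool) \<Rightarrow> 'a set" where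
  "level_set S b x = {v\<in>S. x v = b}"

lemma level_set_Int: "level_set S b x \<inter> S' = level_set (S \<inter> S') b x"
  by (auto simp: level_set_def)

lemma level_set_eq_iff: "T \<subseteq> S \<Longrightarrow> level_set S b x = T \<longleftrightarrow> (\<forall>v\<in>S. x v = (v \<in> T \<longleftrightarrow> b))"
  by (auto simp: level_set_def)

lemma measurable_level_set:
  assumes S: "finite S" "S \<subseteq> V" and M: "sets M = sets (PiM V (\<lambda>_. count_space (UNIV :: bool set)))"
  shows "level_set S b \<in> M \<rightarrow>\<^sub>M count_space (Pow S)"
proof (rule measurable_count_space_eq2[THEN iffD2], safe)
  fix T assume T: "T \<subseteq> S"
  have [measurable]: "(\<lambda>x. x v) \<in> measurable M (count_space UNIV)" if "v \<in> S" for v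
    using that S measurable_component_singleton[of v V "\<lambda>_. count_space (UNIV :: bool set)"]
    by (auto simp: measurable_cong_sets[OF M refl])
  have "level_set S b -` {T} \<inter> space M = {x\<in>space M. \<forall>v\<in>S. x v = (v \<in> T \<longleftrightarrow> b)}"
    using level_set_eq_iff[OF T] by auto
  also have "\<dots> \<in> sets M"
    using S(1) by (intro sets.sets_Collect_finite_All) simp_all
  finally show "level_set S b -` {T} \<inter> space M \<in> sets M" .
qed (use S in \<open>auto simp: level_set_def\<close>)

lemma sets_level_set:
  assumes "finite S" "S \<subseteq> V" "sets M = sets (PiM V (\<lambda>_. count_space (UNIV :: bool set)))"
  shows "{x \<in> space M. P (level_set S b x)} \<in> sets M"
proof -
  have "{x \<in> space M. P (level_set S b x)} = level_set S b -` {T\<in>Pow S. P T} \<inter> space M"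
    by (auto simp: level_set_def)
  also have "\<dots> \<in> sets M"
    by (rule measurable_sets[OF measurable_level_set[OF assms]]) auto
  finally show ?thesis .
qed

text \<open>Finite Borel measures on Polish spaces are inner regular, so configurations are carried
  to sequences in \<open>nat \<Rightarrow> real\<close>. The compact sets live there, and sequential
  compactness turns the finitary bounds \<open>cyl\<close> into a bound for
  \<open>A\<close>.\<close>

lemma upset_measure_le:
  fixes V :: "'v set"
  defines "S \<equiv> PiM V (\<lambda>_. count_space (UNIV :: bool set))"
  assumes V: "countable V" and M: "finite_measure M" "sets M = sets S"
    and N: "finite_measure N" "sets N = sets S"
    and cyl: "\<And>U P. finite U \<Longrightarrow> U \<subseteq> V \<Longrightarrow> (\<And>T T'. T \<subseteq> T' \<Longrightarrow> T' \<subseteq> U \<Longrightarrow> P T \<Longrightarrow> P T') \<Longrightarrow>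
      measure M {x\<in>space S. P (level_set U b x)} \<le> measure N {x\<in>space S. P (level_set U b x)}"
    and A: "A \<in> sets S" "\<And>x y. x \<in> A \<Longrightarrow> y \<in> space S \<Longrightarrow> level_set V b x \<subseteq> level_set V b y \<Longrightarrow> y \<in> A"
  shows "measure M A \<le> measure N A"
proof -
  interpret M: finite_measure M by fact
  interpret N: finite_measure N by fact
  have spM: "space M = space S" and spN: "space N = space S"
    using M N by (auto dest: sets_eq_imp_space_eq)
  define idx where "idx = to_nat_on V"
  have inj: "inj_on idx V" using V by (simp add: idx_def inj_on_to_nat_on)
  \<comment> \<open>Coordinate \<open>idx v\<close> is 1 exactly if \<open>v\<close> has colour
    \<open>b\<close>; coordinates that index no vertex are 0. The left inverse \<open>dec\<close>
    decodes every sequence by cutting at 1/2; exceeding 1/2 is an open condition, which the limit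
    argument below exploits.\<close>
  define enc :: "('v \<Rightarrow> bool) \<Rightarrow> nat \<Rightarrow> real"
    where "enc x = (\<lambda>n. of_bool (\<exists>v\<in>V. idx v = n \<and> x v = b))" for x
  define dec :: "(nat \<Rightarrow> real) \<Rightarrow> 'v \<Rightarrow> bool"
    where "dec y = (\<lambda>v\<in>V. (y (idx v) > 1/2) = b)" for y
  have enc_idx: "enc x (idx v) = of_bool (x v = b)" if "v \<in> V" for x v
    using that inj by (auto simp: enc_def inj_on_eq_iff)
  have dec_enc: "dec (enc x) = x" if "x \<in> space S" for x
    using that by (auto simp: dec_def enc_idx S_def space_PiM PiE_def extensional_def fun_eq_iff)
  have enc_meas: "enc \<in> borel_measurable M"
  proof (rule measurable_coordinatewise_then_product)
    fix n
    have "(\<lambda>x. x v) \<in> measurable M (count_space UNIV)" if "v \<in> V" for v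
      using that M(2) measurable_component_singleton[of v V "\<lambda>_. count_space (UNIV :: bool set)"]
      by (simp add: S_def cong: measurable_cong_sets)
    note [measurable] = this
    show "(\<lambda>x. enc x n) \<in> borel_measurable M"
    proof (cases "\<exists>v\<in>V. idx v = n")
      case True
      then obtain v where v: "v \<in> V" "idx v = n" by blast
      hence "(\<lambda>x. enc x n) = (\<lambda>x. of_bool (x v = b))" using enc_idx by auto
      thus ?thesis using v(1) by simp
    next
      case False
      hence "(\<lambda>x. enc x n) = (\<lambda>_. 0)" by (auto simp: enc_def)
      thus ?thesis by simp
    qed
  qed
  have dec_meas: "dec \<in> measurable borel S"
    unfolding S_def
  proof (rule measurable_PiM_single')
    fix v assume "v \<in> V"
    have "(\<lambda>y :: nat \<Rightarrow> real. y (idx v)) \<in> borel_measurable borel"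
      by (intro borel_measurable_continuous_onI continuous_on_product_coordinates)
    hence "Measurable.pred borel (\<lambda>y :: nat \<Rightarrow> real. (y (idx v) > 1/2) = b)" by measurable
    thus "(\<lambda>y. dec y v) \<in> borel \<rightarrow>\<^sub>M count_space UNIV"
      using \<open>v \<in> V\<close> by (simp add: dec_def)
  qed (auto simp: dec_def)
  define B where "B = dec -` A"
  have B: "B \<in> sets borel"
    using measurable_sets[OF dec_meas A(1)] by (simp add: B_def)
  have A_sp: "A \<subseteq> space S" using A(1) sets.sets_into_space by blast
  have encB: "enc -` B \<inter> space M = A"
    using dec_enc A_sp by (auto simp: B_def spM)
  let ?D = "distr M borel enc"
  interpret D: finite_measure ?D by (rule M.finite_measure_distr[OF enc_meas])
  have compact_le: "measure ?D K \<le> measure N A" if K: "compact K" "K \<subseteq> B" for K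
  proof -
    define ons where "ons = (\<lambda>y. {v\<in>V. y (idx v) = (1::real)})"
    define U where "U n = {v\<in>V. idx v < n}" for n
    have finU: "finite (U n)" for n
    proof -
      have "idx ` U n \<subseteq> {..<n}" by (auto simp: U_def)
      moreover have "inj_on idx (U n)" using inj by (rule inj_on_subset) (auto simp: U_def)
      ultimately show ?thesis using finite_imageD finite_subset by blast
    qed
    \<comment> \<open>\<open>K'\<close> keeps the 0-1 sequences of \<open>K\<close>, among them
      every encoding in \<open>K\<close>. \<open>C n\<close> is the upward closure of
      \<open>K'\<close> as far as the vertices of index below \<open>n\<close> can tell, so it
      shrinks as \<open>n\<close> grows.\<close>
    define K' where "K' = {y\<in>K. \<forall>n. y n = 0 \<or> y n = 1}"
    define P where "P n T \<longleftrightarrow> (\<exists>y\<in>K'. ons y \<inter> U n \<subseteq> T)" for n T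
    define C where "C n = {x\<in>space S. P n (level_set (U n) b x)}" for n
    have C_sets: "C n \<in> sets S" for n
      unfolding C_def S_def using finU by (intro sets_level_set) (auto simp: U_def)
    have "decseq C"
    proof (rule decseq_SucI)
      show "C (Suc n) \<subseteq> C n" for n
        by (fastforce simp: C_def P_def U_def level_set_def)
    qed
    have sub1: "enc -` K \<inter> space M \<subseteq> C n" for n
    proof
      fix x assume x: "x \<in> enc -` K \<inter> space M"
      hence "enc x \<in> K'" by (auto simp: K'_def enc_def)
      moreover have "ons (enc x) \<inter> U n \<subseteq> level_set (U n) b x"
        by (auto simp: ons_def level_set_def enc_idx U_def)
      ultimately show "x \<in> C n" using x by (auto simp: C_def P_def spM)
    qed
    have sub2: "(\<Inter>n. C n) \<subseteq> A"
    proof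
      fix x assume x: "x \<in> (\<Inter>n. C n)"
      hence xS: "x \<in> space S" by (auto simp: C_def)
      \<comment> \<open>For each \<open>n\<close> some element of \<open>K'\<close> lies below
        \<open>x\<close> on \<open>U n\<close>. A limit \<open>l\<close> of a subsequence of these
        witnesses decodes to an element of \<open>A\<close> below \<open>x\<close>, and
        \<open>A\<close> is closed upwards.\<close>
      have "\<forall>n. \<exists>y\<in>K'. ons y \<inter> U n \<subseteq> level_set (U n) b x" using x by (auto simp: C_def P_def)
      then obtain y where y: "\<And>n. y n \<in> K'" "\<And>n. ons (y n) \<inter> U n \<subseteq> level_set (U n) b x" by metis
      have "\<forall>n. y n \<in> K" using y by (auto simp: K'_def)
      then obtain l r where l: "l \<in> K" "strict_mono r" "(y \<circ> r) \<longlonglongrightarrow> l"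
        using K(1) unfolding compact_eq_seq_compact_metric seq_compact_def by metis
      have coord: "(\<lambda>n. y (r n) i) \<longlonglongrightarrow> l i" for i
      proof -
        have "isCont (\<lambda>z :: nat \<Rightarrow> real. z i) l"
          by (rule continuous_on_eq_continuous_at[OF open_UNIV, THEN iffD1, rule_format])
            (auto intro: continuous_on_product_coordinates)
        from isCont_tendsto_compose[OF this l(3)] show ?thesis by (simp add: o_def)
      qed
      have "level_set V b (dec l) \<subseteq> level_set V b x"
      proof
        fix v assume "v \<in> level_set V b (dec l)"
        hence v: "v \<in> V" "l (idx v) > 1/2" by (auto simp: level_set_def dec_def)
        have "eventually (\<lambda>n. y (r n) (idx v) > 1/2) sequentially"
          using order_tendstoD(1)[OF coord v(2)] .
        moreover have "eventually (\<lambda>n. n > idx v) sequentially" by (rule eventually_gt_at_top)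
        ultimately have "eventually (\<lambda>n. y (r n) (idx v) > 1/2 \<and> n > idx v) sequentially"
          by eventually_elim auto
        then obtain n where n: "y (r n) (idx v) > 1/2" "n > idx v"
          using eventually_happens by force
        have "y (r n) (idx v) = 0 \<or> y (r n) (idx v) = 1" using y(1)[of "r n"] by (auto simp: K'_def)
        hence "y (r n) (idx v) = 1" using n by auto
        \<comment> \<open>Along a subsequence \<open>n \<le> r n\<close>, so the window
          \<open>U (r n)\<close> already contains \<open>v\<close>.\<close>
        moreover have "idx v < r n" using n(2) seq_suble[OF l(2), of n] by linarith
        ultimately have "v \<in> ons (y (r n)) \<inter> U (r n)" using v by (auto simp: ons_def U_def)
        thus "v \<in> level_set V b x" using y(2)[of "r n"] v by (auto simp: level_set_def)
      qed
      moreover have "dec l \<in> A" using l(1) K(2) by (auto simp: B_def)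
      ultimately show "x \<in> A" using A(2) xS by blast
    qed
    have "measure ?D K = measure M (enc -` K \<inter> space M)"
      using K(1) enc_meas by (intro measure_distr) (auto dest: compact_imp_closed)
    also have "\<dots> \<le> measure N (C n)" for n
    proof -
      have "measure M (enc -` K \<inter> space M) \<le> measure M (C n)"
        using sub1 C_sets M(2) by (intro M.finite_measure_mono) auto
      also have "\<dots> \<le> measure N (C n)"
        unfolding C_def
      proof (rule cyl[OF finU])
        show "P n T'" if "T \<subseteq> T'" "P n T" for T T'
          using that unfolding P_def by (meson subset_trans)
      qed (auto simp: U_def)
      finally show ?thesis .
    qed
    finally have "measure ?D K \<le> measure N (C n)" for n .
    moreover have "(\<lambda>n. measure N (C n)) \<longlonglongrightarrow> measure N (\<Inter>n. C n)"
      using C_sets N(2) \<open>decseq C\<close> by (intro N.finite_Lim_measure_decseq) auto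
    ultimately have "measure ?D K \<le> measure N (\<Inter>n. C n)"
      by (intro LIMSEQ_le_const) auto
    also have "\<dots> \<le> measure N A"
      using sub2 A(1) N(2) by (intro N.finite_measure_mono) auto
    finally show ?thesis .
  qed
  have "emeasure ?D B = (SUP K\<in>{K. K \<subseteq> B \<and> compact K}. emeasure ?D K)"
    using B D.emeasure_finite by (intro inner_regular) auto
  also have "\<dots> \<le> ennreal (measure N A)"
    using compact_le by (intro SUP_least) (auto simp: D.emeasure_eq_measure intro!: ennreal_leI)
  finally have "measure ?D B \<le> measure N A" by (simp add: D.emeasure_eq_measure)
  moreover have "measure ?D B = measure M A"
    using measure_distr[OF enc_meas] B encB by simp
  ultimately show ?thesis by simp
qed

section \<open>Approximation by finite subgraphs\<close>

lemma prob_space_nu: "prob_space (nu S a)"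
  unfolding nu_def by (intro prob_space_PiM prob_space_measure_pmf)

lemma sets_nu: "sets (nu S a) = sets (PiM S (\<lambda>_. count_space (UNIV :: bool set)))"
  unfolding nu_def by (intro sets_PiM_cong) auto

lemma integral_finite_valued:
  fixes h :: "'a set \<Rightarrow> real"
  assumes S: "finite S" and M: "prob_space M" and f: "f \<in> M \<rightarrow>\<^sub>M count_space (Pow S)"
  shows "integral\<^sup>L M (\<lambda>x. h (f x)) = (\<Sum>T\<in>Pow S. measure M (f -` {T} \<inter> space M) * h T)"
proof -
  interpret prob_space M by fact
  have fS: "f x \<in> Pow S" if "x \<in> space M" for x
    using measurable_space[OF f that] by simp
  have sets: "f -` {T} \<inter> space M \<in> sets M" if "T \<in> Pow S" for T
    using measurable_sets[OF f, of "{T}"] that by simp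
  have "integral\<^sup>L M (\<lambda>x. h (f x)) = integral\<^sup>L M (\<lambda>x. \<Sum>T\<in>Pow S. h T * indicator (f -` {T} \<inter> space M) x)"
  proof (rule Bochner_Integration.integral_cong)
    fix x assume x: "x \<in> space M"
    have "(\<Sum>T\<in>Pow S. h T * indicator (f -` {T} \<inter> space M) x) = (\<Sum>T\<in>Pow S. if T = f x then h T else 0)"
      using x by (intro sum.cong) (auto simp: indicator_def)
    also have "\<dots> = h (f x)" using fS[OF x] S by simp
    finally show "h (f x) = (\<Sum>T\<in>Pow S. h T * indicator (f -` {T} \<inter> space M) x)" ..
  qed simp
  also have "\<dots> = (\<Sum>T\<in>Pow S. integral\<^sup>L M (\<lambda>x. h T * indicator (f -` {T} \<inter> space M) x))"
  proof (rule Bochner_Integration.integral_sum)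
    show "integrable M (\<lambda>x. h T * indicator (f -` {T} \<inter> space M) x)" if "T \<in> Pow S" for T
      using sets[OF that] by (intro integrable_mult_right integrable_real_indicator) (auto simp: emeasure_eq_measure)
  qed
  also have "\<dots> = (\<Sum>T\<in>Pow S. measure M (f -` {T} \<inter> space M) * h T)"
    by (intro sum.cong) (simp_all add: mult.commute)
  finally show ?thesis .
qed

text \<open>Prescribing the level set prescribes the value at each vertex of \<open>S\<close>, and
  the product measure factorizes. A vertex outside \<open>T\<close> contributes the mass of
  \<open>\<not> b\<close>, which is 1 minus that of \<open>b\<close>.\<close>

lemma integral_nu:
  assumes S: "finite S" "S \<subseteq> V" and a: "0 \<le> a" "a \<le> 1"
  shows "integral\<^sup>L (nu V a) (\<lambda>x. h (level_set S b x)) = bexp (\<lambda>_. pmf (bernoulli_pmf a) b) S h"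
proof -
  let ?q = "pmf (bernoulli_pmf a)"
  interpret product_prob_space "\<lambda>_. measure_pmf (bernoulli_pmf a)" V
    by (intro product_prob_spaceI prob_space_measure_pmf)
  have "measure (nu V a) (level_set S b -` {T} \<inter> space (nu V a)) = (\<Prod>x\<in>T. ?q b) * (\<Prod>x\<in>S - T. 1 - ?q b)"
    if T: "T \<subseteq> S" for T
  proof -
    have "level_set S b -` {T} \<inter> space (nu V a) = {x\<in>space (nu V a). \<forall>v\<in>S. x v \<in> {v \<in> T \<longleftrightarrow> b}}"
      using level_set_eq_iff[OF T] by auto
    also have "emeasure (nu V a) \<dots> = (\<Prod>v\<in>S. emeasure (measure_pmf (bernoulli_pmf a)) {v \<in> T \<longleftrightarrow> b})"
      unfolding nu_def using S by (intro emeasure_PiM_Collect) auto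
    also have "\<dots> = ennreal (\<Prod>v\<in>S. ?q (v \<in> T \<longleftrightarrow> b))"
      by (simp add: emeasure_pmf_single prod_ennreal)
    finally have "measure (nu V a) (level_set S b -` {T} \<inter> space (nu V a)) = (\<Prod>v\<in>S. ?q (v \<in> T \<longleftrightarrow> b))"
      by (simp add: measure_def prod_nonneg)
    also have "\<dots> = (\<Prod>v\<in>T. ?q (v \<in> T \<longleftrightarrow> b)) * (\<Prod>v\<in>S - T. ?q (v \<in> T \<longleftrightarrow> b))"
      using S T by (subst prod.subset_diff[of T S]) (auto simp: mult.commute)
    also have "(\<Prod>v\<in>T. ?q (v \<in> T \<longleftrightarrow> b)) = (\<Prod>v\<in>T. ?q b)"
      by (intro prod.cong) auto
    also have "(\<Prod>v\<in>S - T. ?q (v \<in> T \<longleftrightarrow> b)) = (\<Prod>v\<in>S - T. 1 - ?q b)"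
    proof (rule prod.cong)
      have "?q (\<not> b) = 1 - ?q b" using a by (cases b) simp_all
      thus "?q (v \<in> T \<longleftrightarrow> b) = 1 - ?q b" if "v \<in> S - T" for v using that by simp
    qed simp
    finally show ?thesis .
  qed
  thus ?thesis
    unfolding bexp_def integral_finite_valued[OF S(1) prob_space_nu measurable_level_set[OF S sets_nu]]
    by (intro sum.cong) auto
qed

text \<open>\<open>b\<close> is the colour being counted. \<open>fin\<close> is stated separately
  because \<open>card\<close> sends infinite sets to 0; \<open>bdd\<close> makes the supremum in
  \<open>max_degree\<close> a genuine upper bound.\<close>

locale dac_graph =
  fixes V :: "'v set" and E :: "'e set" and ends :: "'e \<Rightarrow> 'v \<times> 'v" and p r :: real and b :: bool
  assumes graph: "graph V E ends" and V: "countable V"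
    and fin: "\<And>v. v \<in> V \<Longrightarrow> finite (incident E ends v)"
    and bdd: "bdd_above (degree E ends ` V)"
    and pr: "0 \<le> p" "p \<le> 1" "0 \<le> r" "r \<le> 1"
begin

section \<open>Exhaustion by finite induced subgraphs\<close>

abbreviation "idx \<equiv> to_nat_on V"

definition Vn :: "nat \<Rightarrow> 'v set" where "Vn n = {v\<in>V. idx v < n}"
definition En :: "nat \<Rightarrow> 'e set" where "En n = {e\<in>E. fst (ends e) \<in> Vn n \<and> snd (ends e) \<in> Vn n}"

text \<open>The vertices of colour \<open>b\<close> when the model runs on the subgraph
  \<open>(Vn n, En n)\<close>. All \<open>n\<close> share the same edge and colour variables, and
  representatives are chosen by the index used in \<open>cluster_rep\<close>, so the approximations
  are coupled with the full model.\<close>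

definition Xn :: "nat \<Rightarrow> ('e \<Rightarrow> bool) \<times> ('v \<Rightarrow> bool) \<Rightarrow> 'v set" where
  "Xn n oc = coloured idx ends {} True (Vn n) (level_set (En n) True (fst oc)) (level_set (Vn n) b (snd oc))"

lemma inj: "inj_on idx V"
  using V by (rule inj_on_to_nat_on)

lemma Vn: "finite (Vn n)" "Vn n \<subseteq> V" "m \<le> n \<Longrightarrow> Vn m \<subseteq> Vn n"
proof -
  have "idx ` Vn n \<subseteq> {..<n}" by (auto simp: Vn_def)
  moreover have "inj_on idx (Vn n)" using inj by (rule inj_on_subset) (auto simp: Vn_def)
  ultimately show "finite (Vn n)" using finite_imageD finite_subset by blast
qed (auto simp: Vn_def)

lemma En: "finite (En n)" "En n \<subseteq> E" "m \<le> n \<Longrightarrow> En m \<subseteq> En n"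
proof -
  have "En n \<subseteq> (\<Union>v\<in>Vn n. incident E ends v)" by (auto simp: En_def incident_def)
  moreover have "finite (\<Union>v\<in>Vn n. incident E ends v)" using Vn[of n] fin by auto
  ultimately show "finite (En n)" by (rule finite_subset)
  show "m \<le> n \<Longrightarrow> En m \<subseteq> En n" using Vn(3)[of m n] by (auto simp: En_def)
qed (auto simp: En_def)

lemma Vn_eventually:
  assumes "finite U" "U \<subseteq> V" shows "\<exists>N. U \<subseteq> Vn N"
proof -
  have "U \<subseteq> Vn (Suc (Max (idx ` U)))"
    using assms by (auto simp: Vn_def less_Suc_eq_le)
  thus ?thesis ..
qed

text \<open>An open path is finite; the induction enlarges the subgraph at each of its
  edges.\<close>

lemma cluster_eventually:
  assumes "v \<in> V" "w \<in> cluster {e\<in>E. \<omega> e} ends v"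
  shows "\<exists>N. w \<in> cluster (level_set (En N) True \<omega>) ends v"
proof -
  have "(v, w) \<in> (adj {e\<in>E. \<omega> e} ends)\<^sup>*" using assms by (simp add: cluster_def)
  thus ?thesis
  proof (induction rule: rtrancl_induct)
    case (step w z)
    then obtain N where N: "w \<in> cluster (level_set (En N) True \<omega>) ends v" by blast
    obtain e where e: "e \<in> E" "\<omega> e" "ends e = (w, z) \<or> ends e = (z, w)"
      using step.hyps by (auto simp: adj_def)
    have "{w, z} \<subseteq> V" using graph e by (auto simp: graph_def)
    then obtain N' where N': "{w, z} \<subseteq> Vn N'" using Vn_eventually[of "{w, z}"] by auto
    define K where "K = max N N'"
    have "level_set (En N) True \<omega> \<subseteq> level_set (En K) True \<omega>"
      using En(3)[of N K] by (auto simp: level_set_def K_def)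
    from subsetD[OF cluster_mono[OF this] N]
    have "w \<in> cluster (level_set (En K) True \<omega>) ends v" .
    moreover have "{w, z} \<subseteq> Vn K" using N' Vn(3)[of N' K] by (auto simp: K_def)
    hence "e \<in> level_set (En K) True \<omega>" using e by (auto simp: level_set_def En_def)
    hence "(w, z) \<in> adj (level_set (En K) True \<omega>) ends" using e(3) by (auto simp: adj_def)
    ultimately show ?case by (auto simp: cluster_def intro: rtrancl_into_rtrancl)
  qed auto
qed

text \<open>From some \<open>n\<close> on, the subgraph joins \<open>v\<close> to its true
  representative \<open>w\<close>. Clusters of the subgraph are contained in those of the full
  graph, so \<open>w\<close> keeps the least index and \<open>v\<close> consults the same colour
  variable.\<close>

lemma Xn_eventually:
  assumes v: "v \<in> V"
  shows "\<exists>N. \<forall>n\<ge>N. v \<in> Xn n oc \<longleftrightarrow> dac_coloring V E ends oc v = b"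
proof -
  obtain \<omega> c where oc: "oc = (\<omega>, c)" by (cases oc)
  define w where "w = cluster_rep V E ends \<omega> v"
  let ?C = "cluster {e\<in>E. \<omega> e} ends v"
  have w: "w \<in> V" "w \<in> ?C" and w_min: "\<And>u. u \<in> V \<Longrightarrow> u \<in> ?C \<Longrightarrow> idx w \<le> idx u"
    using arg_min_natI[of "\<lambda>w. w \<in> V \<and> w \<in> ?C" v idx] arg_min_nat_le[of "\<lambda>w. w \<in> V \<and> w \<in> ?C" _ idx] v
    unfolding w_def cluster_rep_def by (auto simp: cluster_def)
  obtain N1 where N1: "w \<in> cluster (level_set (En N1) True \<omega>) ends v"
    using cluster_eventually[OF v w(2)] by blast
  obtain N2 where N2: "{v, w} \<subseteq> Vn N2" using Vn_eventually[of "{v, w}"] v w by auto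
  have "v \<in> Xn n oc \<longleftrightarrow> dac_coloring V E ends oc v = b" if n: "n \<ge> max N1 N2" for n
  proof -
    let ?Cn = "cluster (level_set (En n) True \<omega>) ends v"
    let ?P = "\<lambda>w. w \<in> Vn n \<and> w \<in> ?Cn"
    have "level_set (En N1) True \<omega> \<subseteq> level_set (En n) True \<omega>"
      using En(3)[of N1 n] n by (auto simp: level_set_def)
    from subsetD[OF cluster_mono[OF this] N1] have "w \<in> ?Cn" .
    moreover have vw: "{v, w} \<subseteq> Vn n" using N2 Vn(3)[of N2 n] n by auto
    ultimately have "?P w" by simp
    hence 1: "?P (arg_min idx ?P)" "idx (arg_min idx ?P) \<le> idx w"
      using arg_min_natI[of ?P w] arg_min_nat_le[of ?P w] by auto
    moreover have "?Cn \<subseteq> ?C" using En(2)[of n] by (intro cluster_mono) (auto simp: level_set_def)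
    ultimately have "idx w \<le> idx (arg_min idx ?P)" using w_min Vn(2)[of n] by blast
    hence "idx (arg_min idx ?P) = idx w" using 1(2) by (rule order_antisym[rotated])
    moreover have "arg_min idx ?P \<in> V" using 1(1) Vn(2)[of n] by blast
    ultimately have "arg_min idx ?P = w" using inj w(1) by (simp add: inj_on_eq_iff)
    thus ?thesis
      using v vw by (simp add: Xn_def oc coloured_def dac_coloring_def level_set_def w_def)
  qed
  thus ?thesis by blast
qed

section \<open>Measurability and law of the approximations\<close>

abbreviation "Om \<equiv> nu E p \<Otimes>\<^sub>M nu V r"

lemma Xn_subset: "Xn n oc \<subseteq> Vn n"
  by (auto simp: Xn_def coloured_def)

lemma Xn_measurable: "Xn n \<in> Om \<rightarrow>\<^sub>M count_space (Pow (Vn n))"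
proof -
  have [measurable]: "level_set (En n) True \<in> nu E p \<rightarrow>\<^sub>M count_space (Pow (En n))"
    "level_set (Vn n) b \<in> nu V r \<rightarrow>\<^sub>M count_space (Pow (Vn n))"
    by (rule measurable_level_set[OF En(1,2) sets_nu] measurable_level_set[OF Vn(1,2) sets_nu])+
  have 1: "(\<lambda>oc. (level_set (En n) True (fst oc), level_set (Vn n) b (snd oc)))
      \<in> Om \<rightarrow>\<^sub>M count_space (Pow (En n)) \<Otimes>\<^sub>M count_space (Pow (Vn n))"
    by measurable
  have 2: "(\<lambda>(H, D). coloured idx ends {} True (Vn n) H D)
     \<in> count_space (Pow (En n)) \<Otimes>\<^sub>M count_space (Pow (Vn n)) \<rightarrow>\<^sub>M count_space (Pow (Vn n))"
    using En(1) Vn(1) by (subst pair_measure_countable) (auto simp: coloured_def countable_finite)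
  show ?thesis using measurable_compose[OF 1 2] unfolding Xn_def by simp
qed

lemma dac_measurable: "dac_coloring V E ends \<in> Om \<rightarrow>\<^sub>M PiM V (\<lambda>_. count_space UNIV)"
proof (rule measurable_PiM_single')
  fix v assume v: "v \<in> V"
  have [measurable]: "Measurable.pred Om (\<lambda>oc. v \<in> Xn n oc)" for n
    using measurable_compose[OF Xn_measurable[of n], of "\<lambda>T. v \<in> T" "count_space UNIV"] by simp
  \<comment> \<open>The memberships \<open>v \<in> Xn n oc\<close> settle as \<open>n\<close> grows,
    so the event is a countable liminf of measurable events.\<close>
  have "(dac_coloring V E ends oc v = b) \<longleftrightarrow> (\<exists>N. \<forall>n\<in>{N..}. v \<in> Xn n oc)" for oc
    using Xn_eventually[OF v, of oc] by (metis atLeast_iff linorder_le_cases)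
  moreover have "Measurable.pred Om (\<lambda>oc. \<exists>N. \<forall>n\<in>{N..}. v \<in> Xn n oc)" by measurable
  ultimately have "Measurable.pred Om (\<lambda>oc. dac_coloring V E ends oc v = b)" by simp
  \<comment> \<open>Comparing with \<open>b\<close> a second time recovers the colour
    itself.\<close>
  hence "Measurable.pred Om (\<lambda>oc. (dac_coloring V E ends oc v = b) = b)" by measurable
  moreover have "(\<lambda>oc. (dac_coloring V E ends oc v = b) = b) = (\<lambda>oc. dac_coloring V E ends oc v)" by auto
  ultimately show "(\<lambda>oc. dac_coloring V E ends oc v) \<in> Om \<rightarrow>\<^sub>M count_space UNIV" by simp
qed (auto simp: dac_coloring_def)

text \<open>The chance that a cluster gets the counted colour: \<open>r\<close> or
  \<open>1 - r\<close>, according to \<open>b\<close>.\<close>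

definition q :: real where "q = pmf (bernoulli_pmf r) b"

lemma q01: "0 \<le> q" "q \<le> 1"
  by (auto simp: q_def pmf_le_1)

lemma Xn_exp:
  fixes h :: "'v set \<Rightarrow> real"
  shows "integral\<^sup>L Om (\<lambda>oc. h (Xn n oc)) = dac_exp p q idx ends {} True (Vn n) (En n) h"
proof -
  interpret P1: prob_space "nu E p" by (rule prob_space_nu)
  interpret P2: prob_space "nu V r" by (rule prob_space_nu)
  interpret pair_prob_space "nu E p" "nu V r" ..
  have "(\<lambda>oc. h (Xn n oc)) \<in> borel_measurable Om"
    using measurable_compose[OF Xn_measurable[of n], of h borel] by simp
  moreover have "\<bar>h (Xn n oc)\<bar> \<le> (\<Sum>T\<in>Pow (Vn n). \<bar>h T\<bar>)" for oc
    using Vn(1) Xn_subset[of n oc] by (intro member_le_sum[of "Xn n oc" _ "\<lambda>T. \<bar>h T\<bar>"]) auto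
  ultimately have int: "integrable Om (\<lambda>oc. h (Xn n oc))"
    by (intro integrable_const_bound[where B = "\<Sum>T\<in>Pow (Vn n). \<bar>h T\<bar>"]) auto
  have "integral\<^sup>L Om (\<lambda>oc. h (Xn n oc)) = (\<integral>\<omega>. (\<integral>c. h (Xn n (\<omega>, c)) \<partial>nu V r) \<partial>nu E p)"
    using integral_fst'[OF int] by simp
  also have "\<dots> = (\<integral>\<omega>. bexp (\<lambda>_. q) (Vn n)
      (\<lambda>D. h (coloured idx ends {} True (Vn n) (level_set (En n) True \<omega>) D)) \<partial>nu E p)"
    unfolding Xn_def q_def fst_conv snd_conv
    by (subst integral_nu[OF Vn(1,2) pr(3,4)]) simp
  also have "\<dots> = dac_exp p q idx ends {} True (Vn n) (En n) h"
    unfolding dac_exp_def using pr by (subst integral_nu[OF En(1,2) pr(1,2)]) simp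
  finally show ?thesis .
qed

text \<open>Degrees only drop in a subgraph, so each weight there is at least the constant with
  exponent \<open>max_degree V E ends\<close>; then \<open>dac_exp_ge\<close> applies, starting with
  nothing explored.\<close>

lemma Xn_ge:
  assumes "mono_on (Pow (Vn n)) h"
  shows "bexp (\<lambda>_. q * (1 - p) ^ max_degree V E ends) (Vn n) h \<le> dac_exp p q idx ends {} True (Vn n) (En n) h"
proof -
  have deg: "degree (En n) ends v \<le> max_degree V E ends" if v: "v \<in> Vn n" for v
  proof -
    have vV: "v \<in> V" using v Vn by auto
    have "degree (En n) ends v \<le> degree E ends v"
      unfolding degree_def using fin[OF vV] En(2)[of n] by (intro card_mono) (auto simp: incident_def)
    also have "\<dots> \<le> max_degree V E ends"
      unfolding max_degree_def using bdd vV by (rule cSUP_upper[rotated])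
    finally show ?thesis .
  qed
  have "bexp (\<lambda>_. q * (1 - p) ^ max_degree V E ends) (Vn n) h \<le> bexp (weight p q (En n) ends) (Vn n) h"
  proof (rule bexp_mono_param)
    fix v assume v: "v \<in> Vn n"
    have "(1 - p) ^ max_degree V E ends \<le> (1 - p) ^ degree (En n) ends v"
      using deg[OF v] pr by (intro power_decreasing) auto
    moreover have "q * (1 - p) ^ degree (En n) ends v \<le> 1"
      using q01 pr by (intro mult_le_one power_le_one) auto
    ultimately show "0 \<le> q * (1 - p) ^ max_degree V E ends \<and>
        q * (1 - p) ^ max_degree V E ends \<le> weight p q (En n) ends v \<and> weight p q (En n) ends v \<le> 1"
      using q01 pr by (auto simp: weight_def intro: mult_left_mono)
  qed (use Vn assms in auto)
  also have "\<dots> \<le> dac_exp p q idx ends {} True (Vn n) (En n) h"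
  proof (rule dac_exp_ge)
    show "inj_on idx (Vn n)" using inj Vn(2) by (rule inj_on_subset)
    show "w \<in> {} \<union> Vn n" if "(u, w) \<in> adj (En n) ends" for u w
      using that by (auto simp: adj_def En_def)
  qed (use Vn En q01 pr assms in auto)
  finally show ?thesis .
qed

section \<open>Domination on the whole graph\<close>

lemma DaC_prob: "prob_space (DaC V E ends p r)"
proof -
  interpret P1: prob_space "nu E p" by (rule prob_space_nu)
  interpret P2: prob_space "nu V r" by (rule prob_space_nu)
  interpret pair_prob_space "nu E p" "nu V r" ..
  show ?thesis unfolding DaC_def by (rule prob_space_distr[OF dac_measurable])
qed

text \<open>The inequality on \<open>Vn n\<close> has a left side that is the same for all
  \<open>n \<ge> N\<close>. Its right side converges by dominated convergence, since the colours of
  the finitely many vertices in \<open>U\<close> settle.\<close>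

lemma cylinder_le:
  fixes P :: "'v set \<Rightarrow> bool"
  defines "S \<equiv> PiM V (\<lambda>_. count_space (UNIV :: bool set))"
  assumes U: "finite U" "U \<subseteq> V" and P: "\<And>T T'. T \<subseteq> T' \<Longrightarrow> T' \<subseteq> U \<Longrightarrow> P T \<Longrightarrow> P T'"
    and a: "0 \<le> a" "a \<le> 1" "pmf (bernoulli_pmf a) b = q * (1 - p) ^ max_degree V E ends"
  shows "measure (nu V a) {x\<in>space S. P (level_set U b x)}
    \<le> measure (DaC V E ends p r) {x\<in>space S. P (level_set U b x)}" (is "measure _ ?C \<le> measure _ ?C")
proof -
  interpret P1: prob_space "nu E p" by (rule prob_space_nu)
  interpret P2: prob_space "nu V r" by (rule prob_space_nu)
  interpret pair_prob_space "nu E p" "nu V r" ..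
  interpret Na: prob_space "nu V a" by (rule prob_space_nu)
  have C: "?C \<in> sets S" unfolding S_def by (rule sets_level_set[OF U refl])
  have spa: "space (nu V a) = space S" unfolding S_def by (rule sets_eq_imp_space_eq[OF sets_nu])
  \<comment> \<open>Intersecting with \<open>U\<close> allows one function to be evaluated at every
    \<open>Xn n\<close> and in the limit, and extends the monotonicity of \<open>P\<close> to
    arbitrary sets.\<close>
  define h :: "'v set \<Rightarrow> real" where "h T = of_bool (P (T \<inter> U))" for T
  have h_mono: "mono_on A h" for A
    unfolding h_def by (intro monotone_onI) (auto intro: P[of "_ \<inter> U" "_ \<inter> U"])
  obtain N where N: "U \<subseteq> Vn N" using Vn_eventually[OF U] by blast
  have nu_eq: "measure (nu V a) ?C = bexp (\<lambda>_. q * (1 - p) ^ max_degree V E ends) (Vn n) h" if "n \<ge> N" for n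
  proof -
    have "Vn n \<inter> U = U" using N Vn(3)[OF that] by auto
    have "?C \<inter> space S = ?C" by auto
    hence "measure (nu V a) ?C = integral\<^sup>L (nu V a) (indicator ?C)"
      by (simp add: spa)
    also have "\<dots> = integral\<^sup>L (nu V a) (\<lambda>x. h (level_set (Vn n) b x))"
      using \<open>Vn n \<inter> U = U\<close> by (intro Bochner_Integration.integral_cong) (auto simp: spa h_def level_set_Int indicator_def)
    also have "\<dots> = bexp (\<lambda>_. q * (1 - p) ^ max_degree V E ends) (Vn n) h"
      using integral_nu[OF Vn(1,2) a(1,2), where b = b and h = h] a(3) by simp
    finally show ?thesis .
  qed
  have "(\<lambda>n. integral\<^sup>L Om (\<lambda>oc. h (Xn n oc))) \<longlonglongrightarrow> integral\<^sup>L Om (\<lambda>oc. h (level_set V b (dac_coloring V E ends oc)))"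
  proof (rule integral_dominated_convergence[where w = "\<lambda>_. 1"])
    show "(\<lambda>oc. h (Xn n oc)) \<in> borel_measurable Om" for n
      using measurable_compose[OF Xn_measurable[of n], of h borel] by simp
    have "(\<lambda>x. h (level_set V b x)) = (\<lambda>x. h (level_set U b x))"
      using U(2) by (auto simp: h_def level_set_Int Int_absorb1)
    moreover have "(\<lambda>x. h (level_set U b x)) \<in> borel_measurable S"
      using measurable_compose[OF measurable_level_set[OF U refl], of h borel] by (simp add: S_def)
    ultimately show "(\<lambda>oc. h (level_set V b (dac_coloring V E ends oc))) \<in> borel_measurable Om"
      using measurable_compose[OF dac_measurable, of "\<lambda>x. h (level_set V b x)"] by (simp add: S_def)
    show "AE oc in Om. (\<lambda>n. h (Xn n oc)) \<longlonglongrightarrow> h (level_set V b (dac_coloring V E ends oc))"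
    proof (rule AE_I2, rule tendsto_eventually)
      fix oc
      have "\<forall>v\<in>U. eventually (\<lambda>n. v \<in> Xn n oc \<longleftrightarrow> dac_coloring V E ends oc v = b) sequentially"
        using Xn_eventually[of _ oc] U(2) by (auto simp: eventually_sequentially)
      hence "eventually (\<lambda>n. \<forall>v\<in>U. v \<in> Xn n oc \<longleftrightarrow> dac_coloring V E ends oc v = b) sequentially"
        using U(1) by (simp add: eventually_ball_finite)
      thus "eventually (\<lambda>n. h (Xn n oc) = h (level_set V b (dac_coloring V E ends oc))) sequentially"
      proof eventually_elim
        case (elim n)
        hence "Xn n oc \<inter> U = level_set V b (dac_coloring V E ends oc) \<inter> U"
          using U(2) by (auto simp: level_set_def)
        thus ?case by (simp add: h_def)
      qed
    qed
  qed (auto simp: h_def)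
  moreover have "measure (nu V a) ?C \<le> integral\<^sup>L Om (\<lambda>oc. h (Xn n oc))" if "n \<ge> N" for n
    using nu_eq[OF that] Xn_ge[OF h_mono] by (simp add: Xn_exp)
  ultimately have "measure (nu V a) ?C \<le> integral\<^sup>L Om (\<lambda>oc. h (level_set V b (dac_coloring V E ends oc)))"
    by (intro LIMSEQ_le_const) auto
  also have "\<dots> = integral\<^sup>L Om (indicator (dac_coloring V E ends -` ?C \<inter> space Om))"
    using measurable_space[OF dac_measurable] U(2)
    by (intro Bochner_Integration.integral_cong)
       (auto simp: h_def level_set_Int indicator_def S_def Int_absorb1)
  also have "\<dots> = measure Om (dac_coloring V E ends -` ?C \<inter> space Om)"
    by simp
  also have "\<dots> = measure (DaC V E ends p r) ?C"
    unfolding DaC_def using C dac_measurable by (subst measure_distr) (auto simp: S_def)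
  finally show ?thesis .
qed

lemma upset_le:
  defines "S \<equiv> PiM V (\<lambda>_. count_space (UNIV :: bool set))"
  assumes a: "0 \<le> a" "a \<le> 1" "pmf (bernoulli_pmf a) b = q * (1 - p) ^ max_degree V E ends"
    and A: "A \<in> sets S" "\<And>x y. x \<in> A \<Longrightarrow> y \<in> space S \<Longrightarrow> level_set V b x \<subseteq> level_set V b y \<Longrightarrow> y \<in> A"
  shows "measure (nu V a) A \<le> measure (DaC V E ends p r) A"
proof (rule upset_measure_le[OF V])
  show "finite_measure (nu V a)" "finite_measure (DaC V E ends p r)"
    using prob_space_nu DaC_prob by (auto intro: prob_space.finite_measure)
  show "sets (nu V a) = sets (PiM V (\<lambda>_. count_space UNIV))" by (rule sets_nu)
  show "sets (DaC V E ends p r) = sets (PiM V (\<lambda>_. count_space UNIV))" by (simp add: DaC_def)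
  show "A \<in> sets (PiM V (\<lambda>_. count_space UNIV))" using A(1) by (simp add: S_def)
qed (use A(2) in \<open>auto simp: S_def intro: cylinder_le[OF _ _ _ a]\<close>)

end

section \<open>Stochastic domination\<close>

text \<open>Up to an arbitrarily small error, \<open>f\<close> is a staircase whose integral is a
  nonnegative combination of measures of superlevel sets, plus a constant.\<close>

lemma integral_mono_superlevel:
  fixes f :: "'a \<Rightarrow> real"
  assumes M: "prob_space M" and N: "prob_space N" and sets: "sets M = sets N"
    and f: "f \<in> borel_measurable M" and B: "\<And>x. x \<in> space M \<Longrightarrow> \<bar>f x\<bar> \<le> B"
    and le: "\<And>t. measure M {x\<in>space M. t \<le> f x} \<le> measure N {x\<in>space N. t \<le> f x}"
  shows "integral\<^sup>L M f \<le> integral\<^sup>L N f"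
proof (rule field_le_epsilon)
  fix e :: real assume e: "e > 0"
  have sp: "space M = space N" by (rule sets_eq_imp_space_eq[OF sets])
  have fN: "f \<in> borel_measurable N" using f by (simp add: measurable_cong_sets[OF sets refl])
  define d where "d = e / 2"
  have d: "d > 0" using e by (simp add: d_def)
  \<comment> \<open>\<open>m\<close> steps of height \<open>d\<close> starting from
    \<open>-B\<close> reach \<open>B\<close>, so the grid covers the range of \<open>f\<close>;
    \<open>g\<close> rounds \<open>f\<close> down to the grid.\<close>
  define m where "m = nat \<lceil>2 * B / d\<rceil>"
  define g where "g x = - B + d * (\<Sum>k\<in>{1..m}. indicator {x\<in>space M. - B + d * real k \<le> f x} x)" for x
  have approx: "g x \<le> f x \<and> f x \<le> g x + d" if x: "x \<in> space M" for x
  proof -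
    define j where "j = nat \<lfloor>(f x + B) / d\<rfloor>"
    have B': "- B \<le> f x" "f x \<le> B" using B[OF x] by auto
    have fl: "real j \<le> (f x + B) / d" "(f x + B) / d < real j + 1"
      unfolding j_def using B' d by (simp_all add: of_nat_floor)
    have jm: "j \<le> m"
    proof -
      have "(f x + B) / d \<le> 2 * B / d" using B' d by (intro divide_right_mono) auto
      hence "real j \<le> 2 * B / d" using fl by linarith
      thus ?thesis unfolding m_def by linarith
    qed
    have "(\<Sum>k\<in>{1..m}. indicator {x\<in>space M. - B + d * real k \<le> f x} x :: real) = (\<Sum>k\<in>{1..m}. if k \<in> {1..j} then 1 else 0)"
    proof (rule sum.cong)
      fix k assume k: "k \<in> {1..m}"
      have "- B + d * real k \<le> f x \<longleftrightarrow> real k \<le> (f x + B) / d" using d by (simp add: field_simps)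
      also have "\<dots> \<longleftrightarrow> k \<le> j" using fl by linarith
      finally show "indicator {x\<in>space M. - B + d * real k \<le> f x} x = (if k \<in> {1..j} then 1 else 0 :: real)"
        using x k by simp
    qed simp
    also have "\<dots> = (\<Sum>k\<in>{1..m} \<inter> {1..j}. 1)" by (rule sum.inter_restrict[symmetric]) simp
    also have "{1..m} \<inter> {1..j} = {1..j}" using jm by auto
    also have "(\<Sum>k\<in>{1..j}. 1) = real j" by simp
    finally have "g x = - B + d * real j" by (simp add: g_def)
    thus ?thesis using fl d by (simp add: field_simps)
  qed
  have lev: "{x\<in>space M. t \<le> f x} \<in> sets M" for t using f by simp
  have int: "integrable L f \<and> integrable L g \<and>
      integral\<^sup>L L g = - B + d * (\<Sum>k\<in>{1..m}. measure L {x\<in>space M. - B + d * real k \<le> f x})"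
    if L: "prob_space L" "sets L = sets M" for L
  proof -
    interpret L: prob_space L by fact
    have spL: "space L = space M" by (rule sets_eq_imp_space_eq[OF L(2)])
    have "f \<in> borel_measurable L" using f by (simp add: measurable_cong_sets[OF L(2) refl])
    hence "integrable L f" using B by (intro L.integrable_const_bound[where B = B]) (auto simp: spL)
    moreover have ind: "integrable L (indicator {x\<in>space M. t \<le> f x} :: _ \<Rightarrow> real)" for t
      using lev[of t] by (intro integrable_real_indicator) (auto simp: L(2) L.emeasure_eq_measure)
    moreover have "{x\<in>space M. t \<le> f x} \<inter> space L = {x\<in>space M. t \<le> f x}" for t
      using spL by auto
    ultimately show ?thesis unfolding g_def by (simp add: L.prob_space)
  qed
  have "integral\<^sup>L M f \<le> integral\<^sup>L M (\<lambda>x. g x + d)"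
    using int[OF M refl] approx M by (intro integral_mono) (auto intro!: Bochner_Integration.integrable_add prob_space.finite_measure finite_measure.integrable_const)
  also have "\<dots> = integral\<^sup>L M g + d"
  proof -
    interpret prob_space M by fact
    show ?thesis using int[OF M refl] by (simp add: prob_space)
  qed
  also have "integral\<^sup>L M g \<le> integral\<^sup>L N g"
    using int[OF M refl] int[OF N sets[symmetric]] le d sp by (auto intro!: mult_left_mono sum_mono)
  also have "integral\<^sup>L N g \<le> integral\<^sup>L N f"
    using int[OF N sets[symmetric]] approx sp by (intro integral_mono) auto
  finally show "integral\<^sup>L M f \<le> integral\<^sup>L N f + e" using d by (simp add: d_def)
qed

theorem theorem4:
  fixes V :: "'v set" and E :: "'e set" and ends :: "'e \<Rightarrow> 'v \<times> 'v" and p r :: real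
  assumes "graph V E ends"
    and "connected_graph V E ends"
    and "countable V"
    and "\<forall>v\<in>V. finite (incident E ends v)"
    and "bdd_above (degree E ends ` V)"
    and "0 \<le> p" "p \<le> 1" "0 \<le> r" "r \<le> 1"
  shows "st_le (nu V (r * (1 - p) ^ max_degree V E ends)) (DaC V E ends p r)
                (PiM V (\<lambda>_. count_space UNIV))
       \<and> st_le (DaC V E ends p r) (nu V (1 - (1 - r) * (1 - p) ^ max_degree V E ends))
                (PiM V (\<lambda>_. count_space UNIV))"
proof -
  interpret T: dac_graph V E ends p r True by unfold_locales (use assms in auto)
  interpret F: dac_graph V E ends p r False by unfold_locales (use assms in auto)
  let ?S = "PiM V (\<lambda>_. count_space (UNIV :: bool set))"
  let ?c = "(1 - p) ^ max_degree V E ends"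
  let ?mu = "DaC V E ends p r"
  have c: "0 \<le> ?c" "?c \<le> 1" using assms by (auto intro: power_le_one)
  have a: "0 \<le> r * ?c" "r * ?c \<le> 1" using c assms by (auto intro: mult_le_one)
  have a': "0 \<le> (1 - r) * ?c" "(1 - r) * ?c \<le> 1" using c assms by (auto intro: mult_le_one)
  have qT: "pmf (bernoulli_pmf (r * ?c)) True = T.q * ?c"
    using a assms by (simp add: T.q_def)
  \<comment> \<open>The upper bound is the lower bound for white: black density
    \<open>1 - (1 - r) * ?c\<close> means white density \<open>(1 - r) * ?c\<close>.\<close>
  have qF: "pmf (bernoulli_pmf (1 - (1 - r) * ?c)) False = F.q * ?c"
    using a' assms by (simp add: F.q_def)
  have sets_mu: "sets ?mu = sets ?S" by (simp add: DaC_def)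
  note sp = sets_eq_imp_space_eq[OF sets_mu] sets_eq_imp_space_eq[OF sets_nu]
  \<comment> \<open>Elements of the product space agree outside \<open>V\<close>, where they are
    \<open>undefined\<close>, so comparing them on \<open>V\<close> suffices.\<close>
  have below: "x \<le> y" if "x \<in> space ?S" "y \<in> space ?S" "\<And>v. v \<in> V \<Longrightarrow> x v \<Longrightarrow> y v" for x y :: "'v \<Rightarrow> bool"
    using that by (auto simp: le_fun_def space_PiM PiE_def extensional_def)
  have "st_le (nu V (r * ?c)) ?mu ?S"
    unfolding st_le_def
  proof (intro allI impI)
    fix f :: "('v \<Rightarrow> bool) \<Rightarrow> real"
    assume f: "f \<in> borel_measurable ?S" "\<exists>B. \<forall>x\<in>space ?S. \<bar>f x\<bar> \<le> B"
      "\<forall>x\<in>space ?S. \<forall>y\<in>space ?S. x \<le> y \<longrightarrow> f x \<le> f y"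
    obtain B where B: "\<And>x. x \<in> space ?S \<Longrightarrow> \<bar>f x\<bar> \<le> B" using f(2) by blast
    show "integral\<^sup>L (nu V (r * ?c)) f \<le> integral\<^sup>L ?mu f"
    proof (rule integral_mono_superlevel[OF prob_space_nu T.DaC_prob])
      show "measure (nu V (r * ?c)) {x\<in>space (nu V (r * ?c)). t \<le> f x} \<le> measure ?mu {x\<in>space ?mu. t \<le> f x}" for t
        unfolding sp
      proof (rule T.upset_le[OF a qT])
        show "{x\<in>space ?S. t \<le> f x} \<in> sets ?S" using f(1) by simp
        fix x y assume x: "x \<in> {x\<in>space ?S. t \<le> f x}" and y: "y \<in> space ?S"
          and xy: "level_set V True x \<subseteq> level_set V True y"
        have "x \<le> y" using x y xy by (intro below) (auto simp: level_set_def)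
        thus "y \<in> {x\<in>space ?S. t \<le> f x}" using f(3) x y by force
      qed
    qed (use f(1) B in \<open>simp_all add: sets_mu sets_nu sp measurable_cong_sets[OF sets_nu refl]\<close>)
  qed
  moreover have "st_le ?mu (nu V (1 - (1 - r) * ?c)) ?S"
    unfolding st_le_def
  proof (intro allI impI)
    fix f :: "('v \<Rightarrow> bool) \<Rightarrow> real"
    assume f: "f \<in> borel_measurable ?S" "\<exists>B. \<forall>x\<in>space ?S. \<bar>f x\<bar> \<le> B"
      "\<forall>x\<in>space ?S. \<forall>y\<in>space ?S. x \<le> y \<longrightarrow> f x \<le> f y"
    obtain B where B: "\<And>x. x \<in> space ?S \<Longrightarrow> \<bar>f x\<bar> \<le> B" using f(2) by blast
    let ?nu = "nu V (1 - (1 - r) * ?c)"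
    show "integral\<^sup>L ?mu f \<le> integral\<^sup>L ?nu f"
    proof (rule integral_mono_superlevel[OF T.DaC_prob prob_space_nu])
      fix t
      have lev: "{x\<in>space ?S. f x < t} \<in> sets ?S" using f(1) by simp
      \<comment> \<open>A sublevel set of an increasing function is increasing in the set of white
        vertices, so the instance \<open>F\<close> applies; taking complements below reverses the
        inequality for superlevel sets.\<close>
      have "measure ?nu {x\<in>space ?S. f x < t} \<le> measure ?mu {x\<in>space ?S. f x < t}"
      proof (rule F.upset_le[OF _ _ qF lev])
        fix x y assume x: "x \<in> {x\<in>space ?S. f x < t}" and y: "y \<in> space ?S"
          and xy: "level_set V False x \<subseteq> level_set V False y"
        have "y \<le> x" using x y xy by (intro below) (auto simp: level_set_def)
        thus "y \<in> {x\<in>space ?S. f x < t}" using f(3) x y by force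
      qed (use a' in auto)
      moreover have compl: "measure L {x\<in>space L. t \<le> f x} = 1 - measure L {x\<in>space ?S. f x < t}"
        if L: "prob_space L" "sets L = sets ?S" for L
      proof -
        interpret prob_space L by fact
        have "space L = space ?S" by (rule sets_eq_imp_space_eq[OF L(2)])
        hence "{x\<in>space L. t \<le> f x} = space L - {x\<in>space ?S. f x < t}" by auto
        thus ?thesis using prob_compl[of "{x\<in>space ?S. f x < t}"] lev L(2) by simp
      qed
      ultimately show "measure ?mu {x\<in>space ?mu. t \<le> f x} \<le> measure ?nu {x\<in>space ?nu. t \<le> f x}"
        by (simp only: compl[OF T.DaC_prob sets_mu] compl[OF prob_space_nu sets_nu] diff_left_mono)
    qed (use f(1) B in \<open>simp_all add: sets_mu sets_nu sp measurable_cong_sets[OF sets_mu refl]\<close>)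
  qed
  ultimately show ?thesis ..
qed

end
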